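(* For every odd integer $m\ge 3$ and every positive integer $n\equiv 0\pmod 4$, there exists an integer Heffter array $H(m,n)$.
   Context: An integer Heffter array $H(m,n)$ is an $m\times n$ array with entries from $\{-mn,\dots,mn\}$ such that every row and every column sums to $0$ over the integers and no element from any pair $\{x,-x\}$ appears twice, so the multiset of absolute values of the entries is exactly $\{1,\dots,mn\}$. *)

theory Defs
  imports Main "HOL-Library.Multiset"
begin

text \<open>
  An \<open>m \<times> n\<close> array is a function \<open>A\<close> on pairs of indices, of which only the values \<open>A i j\<close> with
  \<open>i < m\<close> and \<open>j < n\<close> matter. The entry 0 is excluded: the absolute values are required to be
  exactly \<open>1, \<dots>, m * n\<close>, each occurring once (see the lemma below). Injectivity of the absolute
  value on the cells says that each pair \<open>{x, -x}\<close> is met by at most one cell.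
\<close>

definition integer_heffter_array :: "nat \<Rightarrow> nat \<Rightarrow> (nat \<Rightarrow> nat \<Rightarrow> int) \<Rightarrow> bool" where
  "integer_heffter_array m n A \<longleftrightarrow>
     (\<forall>i<m. \<forall>j<n. A i j \<in> {- int (m * n)..int (m * n)} - {0}) \<and>
     (\<forall>i<m. (\<Sum>j<n. A i j) = 0) \<and>
     (\<forall>j<n. (\<Sum>i<m. A i j) = 0) \<and>
     inj_on (\<lambda>(i, j). \<bar>A i j\<bar>) ({..<m} \<times> {..<n})"

lemma integer_heffter_array_abs_values:
  assumes "integer_heffter_array m n A"
  shows "image_mset (\<lambda>(i, j). \<bar>A i j\<bar>) (mset_set ({..<m} \<times> {..<n})) = mset_set {1..int (m * n)}"
proof -
  let ?f = "\<lambda>(i, j). \<bar>A i j\<bar>" and ?C = "{..<m} \<times> {..<n}"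
  have inj: "inj_on ?f ?C"
    and rng: "\<And>i j. i < m \<Longrightarrow> j < n \<Longrightarrow> A i j \<in> {- int (m * n)..int (m * n)} - {0}"
    using assms unfolding integer_heffter_array_def by blast+
  have sub: "?f ` ?C \<subseteq> {1..int (m * n)}"
  proof
    fix x assume "x \<in> ?f ` ?C"
    then obtain i j where ij: "i < m" "j < n" "x = \<bar>A i j\<bar>" by auto
    show "x \<in> {1..int (m * n)}" using rng[OF ij(1,2)] ij(3) by auto
  qed
  have "card (?f ` ?C) = card {1..int (m * n)}"
    by (subst card_image[OF inj]) (simp add: card_cartesian_product nat_mult_distrib)
  hence "?f ` ?C = {1..int (m * n)}"
    using card_subset_eq[OF _ sub] by simp
  thus ?thesis using image_mset_mset_set[OF inj] by simp
qed

end

theory Submission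
  imports Defs
begin

text \<open>
  Adding four rows is easy when \<open>4\<close> divides \<open>n\<close>: fill column \<open>j\<close> with two pairs of consecutive large
  numbers of opposite signs and let the signs follow the pattern \<open>+ - - +\<close> in \<open>j\<close>. This leaves
  \<open>m = 3\<close> and \<open>m = 5\<close>. Write \<open>n = 4 s\<close>. A Skolem sequence of order \<open>n\<close> splits \<open>{1..2 n}\<close> into
  pairs \<open>a\<^sub>d < b\<^sub>d\<close> with \<open>b\<^sub>d - a\<^sub>d = d\<close> for \<open>1 \<le> d \<le> n\<close>, so that the columns
  \<open>(d, n + a\<^sub>d, - (n + b\<^sub>d))\<close> sum to zero and use \<open>1, \<dots>, 3 n\<close>. In the classical sequence all but four
  of them lie in three families in which the entries depend affinely on a parameter. Four
  consecutive members of the first family, with signs \<open>+ - - +\<close>, have zero row sums; so do two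
  consecutive members of the second and of the third family, with signs \<open>+ -\<close> and \<open>- +\<close>, since
  these families have the same slopes. What remains, for each parity of \<open>s \<ge> 2\<close>, are eight columns
  whose entries are affine in \<open>s\<close>, and these can be permuted and signed so that their row
  sums vanish identically in \<open>s\<close>. For \<open>m = 5\<close> the labels \<open>2 k - 1\<close> and \<open>2 k\<close> are interchanged,
  which makes the sum of the triple \<open>\<plusminus> 1\<close>, and this is compensated by the pair
  \<open>3 n + 2 d - 1, 3 n + 2 d\<close>.
\<close>

section \<open>Arrays given by lists of columns\<close>

text \<open>Counting gives the distinctness: there are only \<open>m * n\<close> cells, so if their
  absolute values cover \<open>m * n\<close> numbers, each number is hit exactly once and nothing
  outside the range occurs. Every construction below is therefore checked by coverage alone.\<close>

lemma integer_heffter_arrayI: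
  assumes rows: "\<And>i. i < m \<Longrightarrow> (\<Sum>j<n. A i j) = 0"
    and cols: "\<And>j. j < n \<Longrightarrow> (\<Sum>i<m. A i j) = 0"
    and cover: "\<And>x. 1 \<le> x \<Longrightarrow> x \<le> int (m * n) \<Longrightarrow> \<exists>i<m. \<exists>j<n. \<bar>A i j\<bar> = x"
  shows "integer_heffter_array m n A"
proof -
  let ?f = "\<lambda>(i, j). \<bar>A i j\<bar>" and ?C = "{..<m} \<times> {..<n}"
  have sub: "{1..int (m * n)} \<subseteq> ?f ` ?C"
    using cover by fastforce
  have le: "card (?f ` ?C) \<le> m * n"
    using card_image_le[of ?C ?f] by (simp add: card_cartesian_product)
  have img: "{1..int (m * n)} = ?f ` ?C"
    by (rule card_seteq[OF _ sub]) (use le in \<open>auto simp: nat_mult_distrib\<close>)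
  have "card (?f ` ?C) = card ?C"
    unfolding img[symmetric] by (simp add: card_cartesian_product nat_mult_distrib)
  hence inj: "inj_on ?f ?C"
    by (intro eq_card_imp_inj_on) auto
  have "A i j \<in> {- int (m * n)..int (m * n)} - {0}" if "i < m" "j < n" for i j
  proof -
    have "\<bar>A i j\<bar> \<in> {1..int (m * n)}"
      unfolding img using that by force
    thus ?thesis by auto
  qed
  thus ?thesis
    using rows cols inj unfolding integer_heffter_array_def by blast
qed

lemma integer_heffter_array_of_columns:
  assumes len: "length cs = n"
    and cols: "\<And>c. c \<in> set cs \<Longrightarrow> length c = m \<and> sum_list c = 0"
    and rows: "\<And>i. i < m \<Longrightarrow> (\<Sum>c\<leftarrow>cs. c ! i) = 0"
    and cover: "\<And>x. 1 \<le> x \<Longrightarrow> x \<le> int (m * n) \<Longrightarrow> \<exists>c\<in>set cs. x \<in> abs ` set c"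
  shows "integer_heffter_array m n (\<lambda>i j. cs ! j ! i)"
proof (rule integer_heffter_arrayI)
  fix i assume "i < m"
  thus "(\<Sum>j<n. cs ! j ! i) = 0"
    using rows[of i] len by (simp add: sum_list_sum_nth atLeast0LessThan)
next
  fix j assume "j < n"
  hence "length (cs ! j) = m \<and> sum_list (cs ! j) = 0"
    using cols len by simp
  thus "(\<Sum>i<m. cs ! j ! i) = 0"
    by (auto simp: sum_list_sum_nth atLeast0LessThan)
next
  fix x assume "1 \<le> x" "x \<le> int (m * n)"
  then obtain c where c: "c \<in> set cs" "x \<in> abs ` set c"
    using cover by blast
  then obtain j where j: "j < n" "c = cs ! j"
    using len by (metis in_set_conv_nth)
  obtain i where "i < length c" "\<bar>c ! i\<bar> = x"
    using c(2) by (auto simp: in_set_conv_nth)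
  thus "\<exists>i<m. \<exists>j<n. \<bar>cs ! j ! i\<bar> = x"
    using cols[OF c(1)] j by auto
qed

section \<open>Adding four rows\<close>

text \<open>On each block of four consecutive indices the pattern + - - + annihilates constants and,
  since 0 - 1 - 2 + 3 = 0, linear terms.\<close>

lemma sum_alternating_affine:
  fixes \<alpha> \<beta> :: int
  assumes "4 dvd n"
  shows "(\<Sum>j<n. (if j mod 4 \<in> {0, 3} then 1 else -1) * (\<alpha> + \<beta> * int j)) = 0"
proof -
  obtain k where n: "n = 4 * k" using assms by blast
  define f where "f j = (if j mod 4 \<in> {0, 3} then 1 else -1) * (\<alpha> + \<beta> * int j)" for j
  have "(\<Sum>j<4 * k. f j) = 0"
  proof (induction k)
    case (Suc k)
    have "(\<Sum>j<4 * Suc k. f j) =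
        (\<Sum>j<4 * k. f j) + f (4 * k) + f (4 * k + 1) + f (4 * k + 2) + f (4 * k + 3)"
      by (simp add: eval_nat_numeral)
    also have "(4 * k + 1) mod 4 = 1" "(4 * k + 2) mod 4 = 2" "(4 * k + 3) mod 4 = 3"
      by presburger+
    hence "(\<Sum>j<4 * k. f j) + f (4 * k) + f (4 * k + 1) + f (4 * k + 2) + f (4 * k + 3) = 0"
      using Suc.IH by (simp add: f_def algebra_simps)
    finally show ?case .
  qed simp
  thus ?thesis using n by (simp add: f_def)
qed

lemma integer_heffter_array_add_four_rows:
  assumes A: "integer_heffter_array m n A" and n: "4 dvd n"
  shows "\<exists>B. integer_heffter_array (m + 4) n B"
proof -
  define N where "N = int (m * n)"
  define e :: "nat \<Rightarrow> int" where "e j = (if j mod 4 \<in> {0, 3} then 1 else -1)" for j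
  \<comment> \<open>Rows 0 and 1 share the values \<open>N + 1\<close> to \<open>N + 2 * n\<close>,
    rows 2 and 3 the next \<open>2 * n\<close>. Each pair of rows holds two consecutive numbers in
    column \<open>j\<close>; the signs + - - + over \<open>k\<close> cancel the two differences,
    while \<open>e\<close> cancels along each row.\<close>
  define h :: "nat \<Rightarrow> nat \<Rightarrow> int" where
    "h k j = (if k \<in> {0, 3} then 1 else -1) *
       (e j * ((N + (if k < 2 then 0 else 2 * int n) + (if even k then 1 else 2)) + 2 * int j))" for k j
  define B where "B i j = (if i < m then A i j else h (i - m) j)" for i j
  have e: "e j = 1 \<or> e j = -1" for j by (simp add: e_def)
  have A_rows: "(\<Sum>j<n. A i j) = 0" if "i < m" for i
    using A that unfolding integer_heffter_array_def by blast
  have A_cols: "(\<Sum>i<m. A i j) = 0" if "j < n" for j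
    using A that unfolding integer_heffter_array_def by blast
  have A_cover: "\<exists>i<m. \<exists>j<n. \<bar>A i j\<bar> = x" if "1 \<le> x" "x \<le> N" for x
  proof -
    have "x \<in># mset_set {1..int (m * n)}" using that by (simp add: N_def)
    hence "x \<in># image_mset (\<lambda>(i, j). \<bar>A i j\<bar>) (mset_set ({..<m} \<times> {..<n}))"
      using integer_heffter_array_abs_values[OF A] by simp
    thus ?thesis by auto
  qed
  have h_row: "(\<Sum>j<n. h k j) = 0" for k
    unfolding h_def sum_distrib_left[symmetric] unfolding e_def
    using sum_alternating_affine[OF n] by simp
  have abs_h: "\<bar>h k j\<bar> = N + (if k < 2 then 0 else 2 * int n) + (if even k then 1 else 2) + 2 * int j"
    for k j
    using e[of j] by (auto simp: h_def abs_mult N_def)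
  have "integer_heffter_array (m + 4) n B"
  proof (rule integer_heffter_arrayI)
    fix i assume "i < m + 4"
    show "(\<Sum>j<n. B i j) = 0"
      by (cases "i < m") (simp_all add: B_def A_rows h_row)
  next
    fix j assume "j < n"
    have "{..<m + 4} = {..<m} \<union> {m, m + 1, m + 2, m + 3}" by auto
    hence "(\<Sum>i<m + 4. B i j) = (\<Sum>i<m. B i j) + (\<Sum>i\<in>{m, m + 1, m + 2, m + 3}. B i j)"
      by (simp add: sum.union_disjoint)
    also have "(\<Sum>i<m. B i j) = 0"
      using A_cols[OF \<open>j < n\<close>] by (simp add: B_def)
    also have "(\<Sum>i\<in>{m, m + 1, m + 2, m + 3}. B i j) = h 0 j + h 1 j + h 2 j + h 3 j"
      by (simp add: B_def)
    also have "\<dots> = 0"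
      using e[of j] by (auto simp: h_def)
    finally show "(\<Sum>i<m + 4. B i j) = 0" by simp
  next
    fix x assume x: "1 \<le> x" "x \<le> int ((m + 4) * n)"
    show "\<exists>i<m + 4. \<exists>j<n. \<bar>B i j\<bar> = x"
    proof (cases "x \<le> N")
      case True
      then obtain i j where "i < m" "j < n" "\<bar>A i j\<bar> = x"
        using A_cover x by blast
      thus ?thesis
        by (intro exI[of _ i] exI[of _ j] conjI) (auto simp: B_def)
    next
      case False
      define y where "y = nat (x - N - 1)"
      have y: "x = N + 1 + int y" "y < 4 * n"
        using False x by (auto simp: y_def N_def algebra_simps)
      \<comment> \<open>The half of the new range in which \<open>y\<close> lies selects the pair of
        rows, its parity the row within the pair, and the halved offset the column.\<close>
      define k j where "k = (if y < 2 * n then 0 else 2) + y mod 2"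
        and "j = (if y < 2 * n then y else y - 2 * n) div 2"
      have k: "k < 4" and j: "j < n"
        using y(2) by (auto simp: k_def j_def)
      have "\<bar>h k j\<bar> = x"
      proof (cases "y < 2 * n")
        case True
        thus ?thesis unfolding abs_h k_def j_def y(1) by (simp; presburger)
      next
        case False
        thus ?thesis unfolding abs_h k_def j_def y(1) by (simp; presburger)
      qed
      thus ?thesis
        using k j by (intro exI[of _ "m + k"] exI[of _ j]) (auto simp: B_def)
    qed
  qed
  thus ?thesis by blast
qed

section \<open>The Skolem sequence\<close>

text \<open>A triple \<open>(d, a, b)\<close> records the positions \<open>a\<close> and \<open>b = a + d\<close> of the label \<open>d\<close>.\<close>

definition skolem1 :: "int \<Rightarrow> int \<Rightarrow> int \<times> int \<times> int" where
  "skolem1 s r = (4 * s - 2 * r + 2, 4 * s + r - 1, 8 * s - r + 1)"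

definition skolem2 :: "int \<Rightarrow> int \<Rightarrow> int \<times> int \<times> int" where
  "skolem2 s r = (4 * s - 2 * r - 1, r, 4 * s - r - 1)"

definition skolem3 :: "int \<Rightarrow> int \<Rightarrow> int \<times> int \<times> int" where
  "skolem3 s r = (2 * s - 2 * r - 1, s + r + 1, 3 * s - r)"

definition skolem_special :: "int \<Rightarrow> (int \<times> int \<times> int) list" where
  "skolem_special s = [(2 * s + 1, s - 1, 3 * s), (1, s, s + 1), (2 * s - 1, 2 * s, 4 * s - 1),
     (4 * s - 1, 2 * s + 1, 6 * s)]"

text \<open>These are the triples left over when the first family is cut into blocks from
  \<open>u\<close> on and the other two from \<open>v\<close> on. The order matters, since columns
  are matched to it position by position.\<close>

definition skolem_residual :: "int \<Rightarrow> int \<Rightarrow> int \<Rightarrow> (int \<times> int \<times> int) list" where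
  "skolem_residual s u v = skolem_special s @ map (skolem1 s) [1..u - 1] @
     map (skolem2 s) [1..v - 1] @ map (skolem3 s) [1..v - 1]"

text \<open>Each family consists of nested pairs: the sum of the two positions is constant, so a
  step in \<open>r\<close> changes \<open>(d, a, b)\<close> by (-2, 1, -1). The first family carries
  all even labels, the second the odd labels from \<open>2 * s + 3\<close> to
  \<open>4 * s - 3\<close>, the third those from 3 to \<open>2 * s - 3\<close>; the special triples
  supply 1, \<open>2 * s - 1\<close>, \<open>2 * s + 1\<close> and \<open>4 * s - 1\<close>.\<close>

definition skolem :: "int \<Rightarrow> (int \<times> int \<times> int) set" where
  "skolem s = set (skolem_special s) \<union> skolem1 s ` {1..2 * s} \<union> skolem2 s ` {1..s - 2} \<union>
     skolem3 s ` {1..s - 2}"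

lemma skolem_diff: "(d, a, b) \<in> skolem s \<Longrightarrow> b = a + d"
  by (auto simp: skolem_def skolem_special_def skolem1_def skolem2_def skolem3_def)

lemma skolem1_in: "1 \<le> r \<Longrightarrow> r \<le> 2 * s \<Longrightarrow> skolem1 s r \<in> skolem s"
  and skolem2_in: "1 \<le> r \<Longrightarrow> r \<le> s - 2 \<Longrightarrow> skolem2 s r \<in> skolem s"
  and skolem3_in: "1 \<le> r \<Longrightarrow> r \<le> s - 2 \<Longrightarrow> skolem3 s r \<in> skolem s"
  by (auto simp: skolem_def)

lemma skolem_label:
  assumes "2 \<le> s" "1 \<le> d" "d \<le> 4 * s"
  shows "\<exists>a b. (d, a, b) \<in> skolem s"
proof (cases "even d")
  case True
  then obtain k where k: "d = 2 * k" by blast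
  have "skolem1 s (2 * s - k + 1) \<in> skolem s"
    using assms k by (intro skolem1_in) auto
  thus ?thesis using k by (auto simp: skolem1_def)
next
  case False
  then obtain k where k: "d = 2 * k + 1" by (metis oddE)
  consider "k = 0" | "1 \<le> k" "k \<le> s - 2" | "k = s - 1" | "k = s" | "s + 1 \<le> k" "k \<le> 2 * s - 2"
    | "k = 2 * s - 1"
    using assms k by linarith
  thus ?thesis
  proof cases
    case 2
    hence "skolem3 s (s - k - 1) \<in> skolem s" by (intro skolem3_in) auto
    moreover have "fst (skolem3 s (s - k - 1)) = d" using k by (simp add: skolem3_def)
    ultimately show ?thesis by (metis prod.collapse)
  next
    case 5
    hence "skolem2 s (2 * s - k - 1) \<in> skolem s" by (intro skolem2_in) auto
    moreover have "fst (skolem2 s (2 * s - k - 1)) = d" using k by (simp add: skolem2_def)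
    ultimately show ?thesis by (metis prod.collapse)
  qed (use k in \<open>auto simp: skolem_def skolem_special_def\<close>)
qed

lemma skolem_position:
  assumes "2 \<le> s" "1 \<le> y" "y \<le> 8 * s"
  shows "\<exists>d a b. (d, a, b) \<in> skolem s \<and> (y = a \<or> y = b)"
proof -
  \<comment> \<open>The eight isolated values are the positions of the special triples. The six
    intervals are, in increasing order, the left ends of families 2 and 3, the right ends of 3 and
    2, then the left and right ends of family 1.\<close>
  have "y \<le> s - 2 \<or> y \<in> {s - 1, s, s + 1, 2 * s, 2 * s + 1, 3 * s, 4 * s - 1, 6 * s} \<or>
      s + 2 \<le> y \<and> y \<le> 2 * s - 1 \<or> 2 * s + 2 \<le> y \<and> y \<le> 3 * s - 1 \<or>
      3 * s + 1 \<le> y \<and> y \<le> 4 * s - 2 \<or> 4 * s \<le> y \<and> y \<le> 6 * s - 1 \<or> 6 * s + 1 \<le> y"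
    unfolding insert_iff empty_iff by linarith
  then consider "y \<le> s - 2" | "y \<in> {s - 1, s, s + 1, 2 * s, 2 * s + 1, 3 * s, 4 * s - 1, 6 * s}"
    | "s + 2 \<le> y" "y \<le> 2 * s - 1" | "2 * s + 2 \<le> y" "y \<le> 3 * s - 1"
    | "3 * s + 1 \<le> y" "y \<le> 4 * s - 2" | "4 * s \<le> y" "y \<le> 6 * s - 1" | "6 * s + 1 \<le> y"
    by blast
  thus ?thesis
  proof cases
    case 1
    hence "skolem2 s y \<in> skolem s" using assms by (intro skolem2_in) auto
    thus ?thesis by (auto simp: skolem2_def)
  next
    case 2
    thus ?thesis by (auto simp: skolem_def skolem_special_def)
  next
    case 3
    hence "skolem3 s (y - s - 1) \<in> skolem s" by (intro skolem3_in) auto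
    thus ?thesis by (force simp: skolem3_def)
  next
    case 4
    hence "skolem3 s (3 * s - y) \<in> skolem s" by (intro skolem3_in) auto
    thus ?thesis by (force simp: skolem3_def)
  next
    case 5
    hence "skolem2 s (4 * s - 1 - y) \<in> skolem s" by (intro skolem2_in) auto
    thus ?thesis by (force simp: skolem2_def)
  next
    case 6
    hence "skolem1 s (y - 4 * s + 1) \<in> skolem s" by (intro skolem1_in) auto
    thus ?thesis by (force simp: skolem1_def)
  next
    case 7
    hence "skolem1 s (8 * s - y + 1) \<in> skolem s" using assms by (intro skolem1_in) auto
    thus ?thesis by (force simp: skolem1_def)
  qed
qed

section \<open>Assembling the columns\<close>

lemma sum_list_concat_map_zero:
  assumes "\<And>k. k \<in> set ks \<Longrightarrow> (\<Sum>c\<leftarrow>f k. g c) = (0::int)"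
  shows "(\<Sum>c\<leftarrow>concat (map f ks). g c) = 0"
  using assms by (induction ks) auto

lemma ex_block:
  fixes r u v :: int
  assumes "u \<le> r" "r < u + b * int p" "0 < b"
  obtains k j where "k < p" "0 \<le> j" "j < b" "r = u + b * int k + j"
proof
  have "(r - u) div b < int p"
  proof (rule ccontr)
    assume "\<not> ?thesis"
    hence "b * int p \<le> b * ((r - u) div b)" using assms(3) by simp
    also have "\<dots> \<le> r - u"
      using pos_mod_sign[OF assms(3), of "r - u"] mult_div_mod_eq[of b "r - u"] by linarith
    finally show False using assms(2) by simp
  qed
  moreover have nn: "0 \<le> (r - u) div b" using assms by (simp add: pos_imp_zdiv_nonneg_iff)
  ultimately show "nat ((r - u) div b) < p" by linarith
  show "0 \<le> (r - u) mod b" "(r - u) mod b < b" using assms by auto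
  show "r = u + b * int (nat ((r - u) div b)) + (r - u) mod b"
    using nn by simp
qed

text \<open>\<open>R_cover\<close> retains only absolute values, so a column of \<open>R\<close> may
  permute and re-sign its entries. By \<open>uv\<close>, the tails \<open>u..2 * s\<close> and
  \<open>v..s - 2\<close> have lengths \<open>4 * p\<close> and \<open>2 * q\<close> and split
  exactly into blocks. The slope \<open>\<beta> ! i\<close> in row \<open>i\<close> is shared by all
  three families, which lets the second and third cancel each other.\<close>

lemma integer_heffter_array_of_residual:
  fixes col :: "int \<times> int \<times> int \<Rightarrow> int list" and R :: "int list list"
    and s u v :: int and p q m n :: nat
  assumes col: "\<And>t. t \<in> skolem s \<Longrightarrow> length (col t) = m \<and> sum_list (col t) = 0"
    and affine: "\<And>i r. i < m \<Longrightarrow> col (skolem1 s r) ! i = col (skolem1 s 0) ! i + r * \<beta> ! i"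
      "\<And>i r. i < m \<Longrightarrow> col (skolem2 s r) ! i = col (skolem2 s 0) ! i + r * \<beta> ! i"
      "\<And>i r. i < m \<Longrightarrow> col (skolem3 s r) ! i = col (skolem3 s 0) ! i + r * \<beta> ! i"
    and cover: "\<And>x. 1 \<le> x \<Longrightarrow> x \<le> int (m * n) \<Longrightarrow> \<exists>t\<in>skolem s. x \<in> abs ` set (col t)"
    and R_cols: "\<And>c. c \<in> set R \<Longrightarrow> length c = m \<and> sum_list c = 0"
    and R_rows: "\<And>i. i < m \<Longrightarrow> (\<Sum>c\<leftarrow>R. c ! i) = 0"
    and R_cover: "list_all2 (\<lambda>t c. \<forall>x\<in>set (col t). x \<in> set c \<or> - x \<in> set c)
      (skolem_residual s u v) R"
    and uv: "1 \<le> u" "1 \<le> v" "2 * s + 1 = u + 4 * int p" "s - 1 = v + 2 * int q"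
    and n: "n = length R + 4 * p + 4 * q"
  shows "\<exists>A. integer_heffter_array m n A"
proof -
  define neg :: "int list \<Rightarrow> int list" where "neg = map uminus"
  define c1 c2 c3 where "c1 r = col (skolem1 s r)" and "c2 r = col (skolem2 s r)"
    and "c3 r = col (skolem3 s r)" for r
  define B1 where "B1 k = (let r = u + 4 * int k in
    [c1 r, neg (c1 (r + 1)), neg (c1 (r + 2)), c1 (r + 3)])" for k
  \<comment> \<open>The differences \<open>c2 r - c2 (r + 1)\<close> and
    \<open>c3 (r + 1) - c3 r\<close> contribute \<open>- \<beta> ! i\<close> and
    \<open>\<beta> ! i\<close> to row \<open>i\<close>.\<close>
  define B2 where "B2 k = (let r = v + 2 * int k in
    [c2 r, neg (c2 (r + 1)), neg (c3 r), c3 (r + 1)])" for k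
  define cs where "cs = R @ concat (map B1 [0..<p]) @ concat (map B2 [0..<q])"
  have c1: "length (c1 r) = m \<and> sum_list (c1 r) = 0" if "1 \<le> r" "r \<le> 2 * s" for r
    unfolding c1_def by (intro col skolem1_in that)
  have c2: "length (c2 r) = m \<and> sum_list (c2 r) = 0" if "1 \<le> r" "r \<le> s - 2" for r
    unfolding c2_def by (intro col skolem2_in that)
  have c3: "length (c3 r) = m \<and> sum_list (c3 r) = 0" if "1 \<le> r" "r \<le> s - 2" for r
    unfolding c3_def by (intro col skolem3_in that)
  have neg: "length (neg c) = m \<and> sum_list (neg c) = 0" if "length c = m \<and> sum_list c = 0" for c
    using that by (simp add: neg_def uminus_sum_list_map[unfolded comp_def, of "\<lambda>x. x", symmetric])
  have abs_neg: "abs ` set (neg c) = abs ` set c" for c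
    by (simp add: neg_def image_image)
  have B1_cols: "length c = m \<and> sum_list c = 0" if "c \<in> set (B1 k)" "k < p" for c k
  proof -
    have "4 * int k + 4 \<le> 4 * int p" using that(2) by linarith
    thus ?thesis
      using that(1) uv unfolding B1_def Let_def by (auto intro!: c1 neg)
  qed
  have B2_cols: "length c = m \<and> sum_list c = 0" if "c \<in> set (B2 k)" "k < q" for c k
  proof -
    have "2 * int k + 2 \<le> 2 * int q" using that(2) by linarith
    thus ?thesis
      using that(1) uv unfolding B2_def Let_def by (auto intro!: c2 c3 neg)
  qed
  have B1_subset: "set (B1 k) \<subseteq> set cs" if "k < p" for k
    using that by (auto simp: cs_def)
  have B2_subset: "set (B2 k) \<subseteq> set cs" if "k < q" for k
    using that by (auto simp: cs_def)
  show ?thesis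
  proof (intro exI, rule integer_heffter_array_of_columns)
    have "length (concat (map B1 ks)) = 4 * length ks" for ks
      by (induction ks) (auto simp: B1_def Let_def)
    moreover have "length (concat (map B2 ks)) = 4 * length ks" for ks
      by (induction ks) (auto simp: B2_def Let_def)
    ultimately show "length cs = n"
      using n by (simp add: cs_def)
  next
    fix c assume "c \<in> set cs"
    thus "length c = m \<and> sum_list c = 0"
      using R_cols B1_cols B2_cols by (auto simp: cs_def)
  next
    fix i assume i: "i < m"
    have c1_nth: "c1 r ! i = c1 0 ! i + r * \<beta> ! i" for r
      unfolding c1_def by (rule affine(1)[OF i])
    have c2_nth: "c2 r ! i = c2 0 ! i + r * \<beta> ! i" for r
      unfolding c2_def by (rule affine(2)[OF i])
    have c3_nth: "c3 r ! i = c3 0 ! i + r * \<beta> ! i" for r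
      unfolding c3_def by (rule affine(3)[OF i])
    have "(\<Sum>c\<leftarrow>B1 k. c ! i) = 0" if "k < p" for k
    proof -
      have k: "4 * int k + 4 \<le> 4 * int p" using that by linarith
      define r where "r = u + 4 * int k"
      \<comment> \<open>Negation passes through \<open>!\<close> only at valid indices, so the
        lengths of the two negated columns are required.\<close>
      have l: "i < length (c1 (r + 1))" "i < length (c1 (r + 2))"
        using c1[of "r + 1"] c1[of "r + 2"] k uv i by (auto simp: r_def)
      show ?thesis
        unfolding B1_def Let_def r_def[symmetric]
        using c1_nth[of r] c1_nth[of "r + 1"] c1_nth[of "r + 2"] c1_nth[of "r + 3"] l
        by (simp add: neg_def algebra_simps)
    qed
    moreover have "(\<Sum>c\<leftarrow>B2 k. c ! i) = 0" if "k < q" for k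
    proof -
      have k: "2 * int k + 2 \<le> 2 * int q" using that by linarith
      define r where "r = v + 2 * int k"
      have l: "i < length (c2 (r + 1))" "i < length (c3 r)"
        using c2[of "r + 1"] c3[of r] k uv i by (auto simp: r_def)
      show ?thesis
        unfolding B2_def Let_def r_def[symmetric]
        using c2_nth[of r] c2_nth[of "r + 1"] c3_nth[of r] c3_nth[of "r + 1"] l
        by (simp add: neg_def algebra_simps)
    qed
    ultimately show "(\<Sum>c\<leftarrow>cs. c ! i) = 0"
      using R_rows[OF i]
        sum_list_concat_map_zero[where f = B1 and ks = "[0..<p]" and g = "\<lambda>c. c ! i"]
        sum_list_concat_map_zero[where f = B2 and ks = "[0..<q]" and g = "\<lambda>c. c ! i"]
      unfolding cs_def map_append sum_list_append by simp
  next
    fix x assume "1 \<le> x" "x \<le> int (m * n)"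
    then obtain t where t: "t \<in> skolem s" "x \<in> abs ` set (col t)"
      using cover by blast
    consider "t \<in> set (skolem_residual s u v)" | r where "t = skolem1 s r" "u \<le> r" "r < u + 4 * int p"
      | r where "t = skolem2 s r" "v \<le> r" "r < v + 2 * int q"
      | r where "t = skolem3 s r" "v \<le> r" "r < v + 2 * int q"
    proof -
      have "r \<in> {1..u - 1} \<or> u \<le> r \<and> r < u + 4 * int p" if "r \<in> {1..2 * s}" for r
        using that uv by auto
      moreover have "r \<in> {1..v - 1} \<or> v \<le> r \<and> r < v + 2 * int q" if "r \<in> {1..s - 2}" for r
        using that uv by auto
      ultimately show ?thesis
        using t(1) that unfolding skolem_def skolem_residual_def set_append set_map set_upto by blast
    qed
    thus "\<exists>c\<in>set cs. x \<in> abs ` set c"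
    proof cases
      case 1
      then obtain i where i: "i < length (skolem_residual s u v)" "t = skolem_residual s u v ! i"
        by (auto simp: in_set_conv_nth)
      obtain c where c: "c \<in> set R" "\<forall>x\<in>set (col t). x \<in> set c \<or> - x \<in> set c"
        using list_all2_nthD[OF R_cover i(1)] list_all2_lengthD[OF R_cover] i
          nth_mem[of i R] that by metis
      from t(2) obtain y where y: "y \<in> set (col t)" "x = \<bar>y\<bar>" by blast
      hence "x \<in> abs ` set c"
        using c(2) by (metis abs_minus_cancel image_eqI)
      thus ?thesis using c(1) by (auto simp: cs_def)
    next
      case (2 r)
      then obtain k j where k: "k < p" "0 \<le> j" "j < 4" "r = u + 4 * int k + j"
        using ex_block[of u r 4 p] by auto
      have "j = 0 \<or> j = 1 \<or> j = 2 \<or> j = 3" using k by linarith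
      hence "\<exists>c\<in>set (B1 k). x \<in> abs ` set c"
        using t(2) k(4) unfolding 2(1) c1_def[symmetric] B1_def Let_def
        by (elim disjE) (simp_all add: abs_neg add.assoc)
      thus ?thesis using B1_subset[OF k(1)] by blast
    next
      case (3 r)
      then obtain k j where k: "k < q" "0 \<le> j" "j < 2" "r = v + 2 * int k + j"
        using ex_block[of v r 2 q] by auto
      have "j = 0 \<or> j = 1" using k by linarith
      hence "\<exists>c\<in>set (B2 k). x \<in> abs ` set c"
        using t(2) k(4) unfolding 3(1) c2_def[symmetric] B2_def Let_def
        by (elim disjE) (simp_all add: abs_neg add.assoc)
      thus ?thesis using B2_subset[OF k(1)] by blast
    next
      case (4 r)
      then obtain k j where k: "k < q" "0 \<le> j" "j < 2" "r = v + 2 * int k + j"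
        using ex_block[of v r 2 q] by auto
      have "j = 0 \<or> j = 1" using k by linarith
      hence "\<exists>c\<in>set (B2 k). x \<in> abs ` set c"
        using t(2) k(4) unfolding 4(1) c3_def[symmetric] B2_def Let_def
        by (elim disjE) (simp_all add: abs_neg add.assoc)
      thus ?thesis using B2_subset[OF k(1)] by blast
    qed
  qed
qed

section \<open>Three and five rows\<close>

fun column3 :: "int \<Rightarrow> int \<times> int \<times> int \<Rightarrow> int list" where
  "column3 s (d, a, b) = [d, 4 * s + a, - (4 * s + b)]"

text \<open>After the exchange of labels the first three entries sum to -1 for even \<open>d\<close>
  and to 1 for odd \<open>d\<close>; the orientation of the last two entries offsets this. Their
  absolute values are \<open>12 * s + 2 * d - 1\<close> and \<open>12 * s + 2 * d\<close>, which
  exhaust the range above \<open>12 * s\<close>.\<close>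

fun column5 :: "int \<Rightarrow> int \<times> int \<times> int \<Rightarrow> int list" where
  "column5 s (d, a, b) = (if even d
     then [d - 1, 4 * s + a, - (4 * s + b), 12 * s + 2 * d, - (12 * s + 2 * d - 1)]
     else [d + 1, 4 * s + a, - (4 * s + b), 12 * s + 2 * d - 1, - (12 * s + 2 * d)])"

lemma column3_cover:
  assumes "2 \<le> s" "1 \<le> x" "x \<le> 12 * s"
  shows "\<exists>t\<in>skolem s. x \<in> abs ` set (column3 s t)"
proof (cases "x \<le> 4 * s")
  case True
  then obtain a b where "(x, a, b) \<in> skolem s"
    using skolem_label assms by blast
  thus ?thesis
    using assms by (intro bexI[of _ "(x, a, b)"]) auto
next
  case False
  then obtain d a b where "(d, a, b) \<in> skolem s" "x - 4 * s = a \<or> x - 4 * s = b"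
    using skolem_position[of s "x - 4 * s"] assms by auto
  thus ?thesis
    using False assms by (intro bexI[of _ "(d, a, b)"]) auto
qed

lemma column5_cover:
  assumes "2 \<le> s" "1 \<le> x" "x \<le> 20 * s"
  shows "\<exists>t\<in>skolem s. x \<in> abs ` set (column5 s t)"
proof -
  consider "x \<le> 4 * s" | "4 * s < x" "x \<le> 12 * s" | "12 * s < x" by linarith
  thus ?thesis
  proof cases
    case 1
    \<comment> \<open>The small value \<open>x\<close> sits in the column of its partner in the pair
      \<open>2 * k - 1\<close>, \<open>2 * k\<close>.\<close>
    define d where "d = (if even x then x - 1 else x + 1)"
    have "1 \<le> d" "d \<le> 4 * s" using 1 assms unfolding d_def by presburger+
    then obtain a b where "(d, a, b) \<in> skolem s"
      using skolem_label assms by blast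
    thus ?thesis
      using assms by (intro bexI[of _ "(d, a, b)"]) (auto simp: d_def)
  next
    case 2
    then obtain d a b where "(d, a, b) \<in> skolem s" "x - 4 * s = a \<or> x - 4 * s = b"
      using skolem_position[of s "x - 4 * s"] assms by auto
    thus ?thesis
      using 2 assms by (intro bexI[of _ "(d, a, b)"]) auto
  next
    case 3
    define d where "d = (x - 12 * s + 1) div 2"
    have d: "1 \<le> d" "d \<le> 4 * s" "x = 12 * s + 2 * d \<or> x = 12 * s + 2 * d - 1"
      using 3 assms unfolding d_def by presburger+
    then obtain a b where "(d, a, b) \<in> skolem s"
      using skolem_label assms by blast
    thus ?thesis
      using d 3 assms by (intro bexI[of _ "(d, a, b)"]) auto
  qed
qed

lemma column3_affine:
  assumes "i < 3"
  shows "column3 s (skolem1 s r) ! i = column3 s (skolem1 s 0) ! i + r * [-2, 1, 1] ! i"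
    "column3 s (skolem2 s r) ! i = column3 s (skolem2 s 0) ! i + r * [-2, 1, 1] ! i"
    "column3 s (skolem3 s r) ! i = column3 s (skolem3 s 0) ! i + r * [-2, 1, 1] ! i"
proof -
  have "i = 0 \<or> i = 1 \<or> i = 2" using assms by linarith
  thus "column3 s (skolem1 s r) ! i = column3 s (skolem1 s 0) ! i + r * [-2, 1, 1] ! i"
    "column3 s (skolem2 s r) ! i = column3 s (skolem2 s 0) ! i + r * [-2, 1, 1] ! i"
    "column3 s (skolem3 s r) ! i = column3 s (skolem3 s 0) ! i + r * [-2, 1, 1] ! i"
    by (auto simp: skolem1_def skolem2_def skolem3_def)
qed

text \<open>The parity of \<open>d\<close> is constant on each family, so a single branch of
  \<open>column5\<close> applies there, and both branches have the same slopes: \<open>d\<close>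
  falls by 2, \<open>a\<close> rises by 1 and \<open>b\<close> falls by 1 when \<open>r\<close>
  grows by 1.\<close>

lemma column5_affine:
  assumes "i < 5"
  shows "column5 s (skolem1 s r) ! i = column5 s (skolem1 s 0) ! i + r * [-2, 1, 1, -4, 4] ! i"
    "column5 s (skolem2 s r) ! i = column5 s (skolem2 s 0) ! i + r * [-2, 1, 1, -4, 4] ! i"
    "column5 s (skolem3 s r) ! i = column5 s (skolem3 s 0) ! i + r * [-2, 1, 1, -4, 4] ! i"
proof -
  have "i = 0 \<or> i = 1 \<or> i = 2 \<or> i = 3 \<or> i = 4" using assms by linarith
  thus "column5 s (skolem1 s r) ! i = column5 s (skolem1 s 0) ! i + r * [-2, 1, 1, -4, 4] ! i"
    "column5 s (skolem2 s r) ! i = column5 s (skolem2 s 0) ! i + r * [-2, 1, 1, -4, 4] ! i"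
    "column5 s (skolem3 s r) ! i = column5 s (skolem3 s 0) ! i + r * [-2, 1, 1, -4, 4] ! i"
    by (auto simp: skolem1_def skolem2_def skolem3_def)
qed

lemma column3_sum: "t \<in> skolem s \<Longrightarrow> length (column3 s t) = 3 \<and> sum_list (column3 s t) = 0"
  by (cases t) (auto dest: skolem_diff)

lemma column5_sum: "t \<in> skolem s \<Longrightarrow> length (column5 s t) = 5 \<and> sum_list (column5 s t) = 0"
  by (cases t) (auto dest: skolem_diff)

text \<open>
  The following arrangements of the remaining eight columns were found by computer search. Their
  columns are listed in the order of \<open>skolem_residual\<close>.
\<close>

definition residual3_even :: "int \<Rightarrow> int list list" where
  "residual3_even s = [
    [2 * s + 1, 5 * s - 1, - (7 * s)],
    [1, 5 * s, - (5 * s) - 1],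
    [- (6 * s), 8 * s - 1, 1 - 2 * s],
    [1 - 4 * s, - (6 * s) - 1, 10 * s],
    [8 * s, - (12 * s), 4 * s],
    [2 - 4 * s, 12 * s - 1, - (8 * s) - 1],
    [12 * s - 2, - (8 * s) - 2, 4 - 4 * s],
    [- (8 * s) - 3, 6 - 4 * s, 12 * s - 3]]"

definition residual3_odd :: "int \<Rightarrow> int list list" where
  "residual3_odd s = [
    [2 * s + 1, 5 * s - 1, - (7 * s)],
    [5 * s, 1, - (5 * s) - 1],
    [2 * s - 1, 6 * s, 1 - 8 * s],
    [4 * s - 1, 6 * s + 1, - (10 * s)],
    [- (8 * s), - (4 * s), 12 * s],
    [- (8 * s) - 1, 2 - 4 * s, 12 * s - 1],
    [3 - 4 * s, - (4 * s) - 1, 8 * s - 2],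
    [7 * s - 1, - (5 * s) - 2, 3 - 2 * s]]"

definition residual5_odd :: "int \<Rightarrow> int list list" where
  "residual5_odd s = [
    [5 * s - 1, - (7 * s), - (16 * s) - 2, 2 * s + 2, 16 * s + 1],
    [- (5 * s) - 1, - (12 * s) - 2, 2, 12 * s + 1, 5 * s],
    [16 * s - 3, 2 * s, 6 * s, 2 - 16 * s, 1 - 8 * s],
    [4 * s, 20 * s - 3, 6 * s + 1, 2 - 20 * s, - (10 * s)],
    [1 - 4 * s, - (8 * s), 20 * s - 1, 12 * s, - (20 * s)],
    [5 - 20 * s, 8 * s + 1, 1 - 12 * s, 4 * s - 3, 20 * s - 4],
    [20 * s - 7, 2 - 8 * s, 6 - 20 * s, 4 * s - 2, 4 * s + 1],
    [6 - 16 * s, 5 * s + 2, 16 * s - 7, 2 * s - 2, 1 - 7 * s]]"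

definition residual5_even :: "int \<Rightarrow> int list list" where
  "residual5_even s = [
    [- (2 * s) - 2, 1 - 5 * s, 16 * s + 2, 7 * s, - (16 * s) - 1],
    [-2, 5 * s + 1, 12 * s + 2, - (5 * s), - (12 * s) - 1],
    [2 * s, 1 - 8 * s, 2 - 16 * s, 16 * s - 3, 6 * s],
    [20 * s - 2, 3 - 20 * s, - (4 * s), - (6 * s) - 1, 10 * s],
    [- (8 * s), 20 * s - 1, - (20 * s), 1 - 4 * s, 12 * s],
    [1 - 12 * s, 5 - 20 * s, 20 * s - 4, 8 * s + 1, 4 * s - 3],
    [20 * s - 8, 8 * s + 2, 4 * s - 5, 9 - 20 * s, 2 - 12 * s],
    [13 - 20 * s, 20 * s - 12, 3 - 12 * s, 4 * s - 7, 8 * s + 3]]"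

section \<open>Verification of the residual arrangements\<close>

lemma residual3_even_sums:
  "c \<in> set (residual3_even s) \<Longrightarrow> length c = 3 \<and> sum_list c = 0"
  "i < 3 \<Longrightarrow> (\<Sum>c\<leftarrow>residual3_even s. c ! i) = 0"
proof -
  show "c \<in> set (residual3_even s) \<Longrightarrow> length c = 3 \<and> sum_list c = 0"
    by (auto simp: residual3_even_def)
  assume "i < 3"
  hence "i = 0 \<or> i = 1 \<or> i = 2" by linarith
  thus "(\<Sum>c\<leftarrow>residual3_even s. c ! i) = 0"
    by (auto simp: residual3_even_def)
qed

text \<open>The cut 5, 1 suits even \<open>s\<close>: four members of the first family are set
  aside, and \<open>2 * s - 4\<close> is divisible by 4 while \<open>s - 2\<close> is even.\<close>

lemma residual3_even_cover:
  "list_all2 (\<lambda>t c. \<forall>x\<in>set (column3 s t). x \<in> set c \<or> - x \<in> set c)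
     (skolem_residual s 5 1) (residual3_even s)"
  by (simp add: residual3_even_def skolem_residual_def skolem_special_def skolem1_def
      skolem2_def skolem3_def upto.simps)

lemma residual3_odd_sums:
  "c \<in> set (residual3_odd s) \<Longrightarrow> length c = 3 \<and> sum_list c = 0"
  "i < 3 \<Longrightarrow> (\<Sum>c\<leftarrow>residual3_odd s. c ! i) = 0"
proof -
  show "c \<in> set (residual3_odd s) \<Longrightarrow> length c = 3 \<and> sum_list c = 0"
    by (auto simp: residual3_odd_def)
  assume "i < 3"
  hence "i = 0 \<or> i = 1 \<or> i = 2" by linarith
  thus "(\<Sum>c\<leftarrow>residual3_odd s. c ! i) = 0"
    by (auto simp: residual3_odd_def)
qed

text \<open>The cut 3, 2 suits odd \<open>s\<close>: two members of the first family and one of each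
  other family are set aside, and \<open>2 * s - 2\<close> is divisible by 4 while
  \<open>s - 3\<close> is even.\<close>

lemma residual3_odd_cover:
  "list_all2 (\<lambda>t c. \<forall>x\<in>set (column3 s t). x \<in> set c \<or> - x \<in> set c)
     (skolem_residual s 3 2) (residual3_odd s)"
  by (simp add: residual3_odd_def skolem_residual_def skolem_special_def skolem1_def
      skolem2_def skolem3_def upto.simps)

lemma residual5_even_sums:
  "c \<in> set (residual5_even s) \<Longrightarrow> length c = 5 \<and> sum_list c = 0"
  "i < 5 \<Longrightarrow> (\<Sum>c\<leftarrow>residual5_even s. c ! i) = 0"
proof -
  show "c \<in> set (residual5_even s) \<Longrightarrow> length c = 5 \<and> sum_list c = 0"
    by (auto simp: residual5_even_def)
  assume "i < 5"
  hence "i = 0 \<or> i = 1 \<or> i = 2 \<or> i = 3 \<or> i = 4" by linarith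
  thus "(\<Sum>c\<leftarrow>residual5_even s. c ! i) = 0"
    by (auto simp: residual5_even_def)
qed

lemma residual5_even_cover:
  "list_all2 (\<lambda>t c. \<forall>x\<in>set (column5 s t). x \<in> set c \<or> - x \<in> set c)
     (skolem_residual s 5 1) (residual5_even s)"
  by (simp add: residual5_even_def skolem_residual_def skolem_special_def skolem1_def
      skolem2_def skolem3_def upto.simps)

lemma residual5_odd_sums:
  "c \<in> set (residual5_odd s) \<Longrightarrow> length c = 5 \<and> sum_list c = 0"
  "i < 5 \<Longrightarrow> (\<Sum>c\<leftarrow>residual5_odd s. c ! i) = 0"
proof -
  show "c \<in> set (residual5_odd s) \<Longrightarrow> length c = 5 \<and> sum_list c = 0"
    by (auto simp: residual5_odd_def)
  assume "i < 5"
  hence "i = 0 \<or> i = 1 \<or> i = 2 \<or> i = 3 \<or> i = 4" by linarith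
  thus "(\<Sum>c\<leftarrow>residual5_odd s. c ! i) = 0"
    by (auto simp: residual5_odd_def)
qed

lemma residual5_odd_cover:
  "list_all2 (\<lambda>t c. \<forall>x\<in>set (column5 s t). x \<in> set c \<or> - x \<in> set c)
     (skolem_residual s 3 2) (residual5_odd s)"
  by (simp add: residual5_odd_def skolem_residual_def skolem_special_def skolem1_def
      skolem2_def skolem3_def upto.simps)

section \<open>Existence for three and for five rows\<close>

lemma integer_heffter_array_3:
  assumes "n > 0" "4 dvd n"
  shows "\<exists>A. integer_heffter_array 3 n A"
proof -
  obtain k where k: "n = 4 * k" using assms(2) by blast
  have cover: "\<exists>t\<in>skolem (int k). x \<in> abs ` set (column3 (int k) t)"
    if "2 \<le> k" "1 \<le> x" "x \<le> int (3 * n)" for x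
    using that k by (intro column3_cover) auto
  have "k = 1 \<or> (\<exists>j\<ge>1. k = 2 * j) \<or> (\<exists>j\<ge>1. k = 2 * j + 1)"
    using assms(1) k by presburger
  then consider "k = 1" | j where "k = 2 * j" "1 \<le> j" | j where "k = 2 * j + 1" "1 \<le> j"
    by blast
  thus ?thesis
  proof cases
    case 1
    \<comment> \<open>At \<open>s = 1\<close> the special labels collide
      (\<open>2 * s + 1 = 4 * s - 1\<close>), so four columns require an explicit array.\<close>
    let ?cs = "[[1, 8, -9], [2, -12, 10], [3, -7, 4], [-6, 11, -5]] :: int list list"
    have "integer_heffter_array 3 4 (\<lambda>i j. ?cs ! j ! i)"
    proof (rule integer_heffter_array_of_columns)
      fix i :: nat assume "i < 3"
      hence "i = 0 \<or> i = 1 \<or> i = 2" by linarith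
      thus "(\<Sum>c\<leftarrow>?cs. c ! i) = 0" by auto
    next
      have "\<forall>x\<in>set [1..12]. \<exists>c\<in>set ?cs. x \<in> abs ` set c"
        by (simp add: upto.simps del: set_upto)
      thus "\<exists>c\<in>set ?cs. x \<in> abs ` set c" if "1 \<le> x" "x \<le> int (3 * 4)" for x
        using that by simp
    qed auto
    thus ?thesis using 1 k by auto
  next
    case (2 j)
    show ?thesis
    \<comment> \<open>With \<open>k = 2 * j\<close> the tails have lengths
      \<open>2 * k - 4 = 4 * (j - 1)\<close> and \<open>k - 2 = 2 * (j - 1)\<close>.\<close>
    proof (rule integer_heffter_array_of_residual[where s = "int k" and u = 5 and v = 1
          and p = "j - 1" and q = "j - 1" and R = "residual3_even (int k)"
          and \<beta> = "[-2, 1, 1]"])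
      show "\<exists>t\<in>skolem (int k). x \<in> abs ` set (column3 (int k) t)"
        if "1 \<le> x" "x \<le> int (3 * n)" for x
        using cover that 2 by simp
    qed (assumption
        | rule column3_sum column3_affine residual3_even_sums residual3_even_cover
        | use 2 k in \<open>simp add: residual3_even_def\<close>)+
  next
    case (3 j)
    show ?thesis
    \<comment> \<open>With \<open>k = 2 * j + 1\<close> the tails have lengths
      \<open>2 * k - 2 = 4 * j\<close> and \<open>k - 3 = 2 * (j - 1)\<close>.\<close>
    proof (rule integer_heffter_array_of_residual[where s = "int k" and u = 3 and v = 2
          and p = j and q = "j - 1" and R = "residual3_odd (int k)"
          and \<beta> = "[-2, 1, 1]"])
      show "\<exists>t\<in>skolem (int k). x \<in> abs ` set (column3 (int k) t)"
        if "1 \<le> x" "x \<le> int (3 * n)" for x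
        using cover that 3 by simp
    qed (assumption
        | rule column3_sum column3_affine residual3_odd_sums residual3_odd_cover
        | use 3 k in \<open>simp add: residual3_odd_def\<close>)+
  qed
qed

lemma integer_heffter_array_5:
  assumes "n > 0" "4 dvd n"
  shows "\<exists>A. integer_heffter_array 5 n A"
proof -
  obtain k where k: "n = 4 * k" using assms(2) by blast
  have cover: "\<exists>t\<in>skolem (int k). x \<in> abs ` set (column5 (int k) t)"
    if "2 \<le> k" "1 \<le> x" "x \<le> int (5 * n)" for x
    using that k by (intro column5_cover) auto
  have "k = 1 \<or> (\<exists>j\<ge>1. k = 2 * j) \<or> (\<exists>j\<ge>1. k = 2 * j + 1)"
    using assms(1) k by presburger
  then consider "k = 1" | j where "k = 2 * j" "1 \<le> j" | j where "k = 2 * j + 1" "1 \<le> j"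
    by blast
  thus ?thesis
  proof cases
    case 1
    let ?cs = "[[-12, -10, -4, 19, 7], [-11, 18, 17, -8, -16], [3, 5, -14, -9, 15],
      [20, -13, 1, -2, -6]] :: int list list"
    have "integer_heffter_array 5 4 (\<lambda>i j. ?cs ! j ! i)"
    proof (rule integer_heffter_array_of_columns)
      fix i :: nat assume "i < 5"
      hence "i = 0 \<or> i = 1 \<or> i = 2 \<or> i = 3 \<or> i = 4" by linarith
      thus "(\<Sum>c\<leftarrow>?cs. c ! i) = 0" by auto
    next
      have "\<forall>x\<in>set [1..20]. \<exists>c\<in>set ?cs. x \<in> abs ` set c"
        by (simp add: upto.simps del: set_upto)
      thus "\<exists>c\<in>set ?cs. x \<in> abs ` set c" if "1 \<le> x" "x \<le> int (5 * 4)" for x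
        using that by simp
    qed auto
    thus ?thesis using 1 k by auto
  next
    case (2 j)
    show ?thesis
    proof (rule integer_heffter_array_of_residual[where s = "int k" and u = 5 and v = 1
          and p = "j - 1" and q = "j - 1" and R = "residual5_even (int k)"
          and \<beta> = "[-2, 1, 1, -4, 4]"])
      show "\<exists>t\<in>skolem (int k). x \<in> abs ` set (column5 (int k) t)"
        if "1 \<le> x" "x \<le> int (5 * n)" for x
        using cover that 2 by simp
    qed (assumption
        | rule column5_sum column5_affine residual5_even_sums residual5_even_cover
        | use 2 k in \<open>simp add: residual5_even_def\<close>)+
  next
    case (3 j)
    show ?thesis
    proof (rule integer_heffter_array_of_residual[where s = "int k" and u = 3 and v = 2
          and p = j and q = "j - 1" and R = "residual5_odd (int k)"
          and \<beta> = "[-2, 1, 1, -4, 4]"])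
      show "\<exists>t\<in>skolem (int k). x \<in> abs ` set (column5 (int k) t)"
        if "1 \<le> x" "x \<le> int (5 * n)" for x
        using cover that 3 by simp
    qed (assumption
        | rule column5_sum column5_affine residual5_odd_sums residual5_odd_cover
        | use 3 k in \<open>simp add: residual5_odd_def\<close>)+
  qed
qed

section \<open>Induction on the number of rows\<close>

theorem theorem8:
  fixes m n :: nat
  assumes "odd m" and "m \<ge> 3" and "n > 0" and "n mod 4 = 0"
  shows "\<exists>A. integer_heffter_array m n A"
  using assms(1,2)
proof (induction m rule: less_induct)
  case (less m)
  have n: "4 dvd n" using assms(4) by presburger
  \<comment> \<open>Steps of four from 3 and 5 reach every odd number from 3 on; the conjunct
    \<open>m = m - 4 + 4\<close> records that the subtraction does not truncate.\<close>
  have "m = 3 \<or> m = 5 \<or> (odd (m - 4) \<and> 3 \<le> m - 4 \<and> m - 4 < m \<and> m = m - 4 + 4)"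
    using less.prems by presburger
  thus ?case
    using integer_heffter_array_3[OF assms(3) n] integer_heffter_array_5[OF assms(3) n]
      less.IH[of "m - 4"] integer_heffter_array_add_four_rows[OF _ n, of "m - 4"]
    by metis
qed

end
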